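(* Let $m\ge 3$, $Q\ge1$, $\kappa\ge 2$ and $n\ge m^2$ be integers. Let $\boldsymbol{\pi}=(\pi_q)_{q=1,\ldots,Q}$ and $\boldsymbol{p}_{ql}=(\boldsymbol{p}_{ql}(x))_{x\in\{0,\ldots,\kappa-1\}}$, $1\le q\le l\le Q$, be parameters of the static stochastic block model such that the matrix $\mathcal{C}_{m,Q,\kappa}$ formed with the $\boldsymbol{p}_{ql}$ has full row rank and $\pi_q>0$ for $q=1,\ldots,Q$. Then $\boldsymbol{\pi}$ and the $\boldsymbol{p}_{ql}(x)$ are identified up to label swapping from the distribution of $\boldsymbol{X}_n$ over the full model class $\mathcal{M}(n,Q,\{0,\ldots,\kappa-1\})$. That is: if $\tilde{\boldsymbol{\pi}}$, $(\tilde{\boldsymbol{p}}_{ql})$ are any parameters of $\mathcal{M}(n,Q,\{0,\ldots,\kappa-1\})$ inducing the same distribution of $\boldsymbol{X}_n$, then there is a permutation $\sigma$ of $\{1,\ldots,Q\}$ such that $\tilde\pi_q=\pi_{\sigma(q)}$ and $\tilde{\boldsymbol{p}}_{ql}=\boldsymbol{p}_{\sigma(q)\sigma(l)}$ for all $1\le q,l\le Q$.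
   Context: Static stochastic block model $\mathcal{M}(n,Q,\{0,\ldots,\kappa-1\})$: nodes $\{1,\ldots,n\}$, edge set $E=\{\{i,j\}:1\le i\neq j\le n\}$. The latent node states $Z_1,\ldots,Z_n$ are i.i.d. on $\{1,\ldots,Q\}$ with distribution $\boldsymbol{\pi}=(\pi_q)$ (an arbitrary probability vector). The observed vector $\boldsymbol{X}=\boldsymbol{X}_n=(X_{ij})_{\{i,j\}\in E}$ has entries $X_{ij}=X_{ji}\in\{0,\ldots,\kappa-1\}$ which are conditionally independent given $\boldsymbol{Z}=(Z_1,\ldots,Z_n)$, with $$\mathbb{P}(X_{ij}=x\mid \boldsymbol{Z})=\boldsymbol{p}_{Z_iZ_j}(x),$$ where $\boldsymbol{p}_{ql}$, $1\le q,l\le Q$, are probability vectors on $\{0,\ldots,\kappa-1\}$ with $\boldsymbol{p}_{ql}=\boldsymbol{p}_{lq}$. The parameters are $\boldsymbol{\pi}$ and the $\boldsymbol{p}_{ql}$. The matrix $\mathcal{C}_{m,Q,\kappa}$, of dimension $Q^m\times\kappa^{\binom m2}$, is the matrix of conditional distributions of the edge variables given the node states in the model with $m$ nodes and the same $\boldsymbol{p}_{ql}$: for $\boldsymbol{z}\in\{1,\ldots,Q\}^m$ and $\boldsymbol{x}=(x_{ij})_{1\le i<j\le m}\in\{0,\ldots,\kappa-1\}^{\binom m2}$, $$\mathcal{C}_{m,Q,\kappa}(\boldsymbol{z},\boldsymbol{x})=\mathbb{P}(\boldsymbol{X}_m=\boldsymbol{x}\mid\boldsymbol{Z}=\boldsymbol{z})=\prod_{1\le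 i<j\le m}\boldsymbol{p}_{z_iz_j}(x_{ij}).$$ *)

theory Defs
  imports "HOL-Probability.Probability" "Jordan_Normal_Form.DL_Rank"
begin

text \<open>The unordered pair of distinct nodes \<open>i\<close>, \<open>j\<close> is represented by the ordered pair with
  \<open>i < j\<close>; since the connection laws are symmetric (see \<open>sbm_params\<close>), nothing depends on this
  choice. An edge vector is a function that is \<open>undefined\<close> outside \<open>edges n\<close>, a state vector is one
  that is \<open>undefined\<close> outside \<open>{1..n}\<close>.\<close>

definition edges :: "nat \<Rightarrow> (nat \<times> nat) set" where
  "edges n = {(i, j). 1 \<le> i \<and> i < j \<and> j \<le> n}"

definition states :: "nat \<Rightarrow> nat \<Rightarrow> (nat \<Rightarrow> nat) set" where
  "states n Q = {1..n} \<rightarrow>\<^sub>E {1..Q}"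

definition edge_vecs :: "nat \<Rightarrow> nat \<Rightarrow> (nat \<times> nat \<Rightarrow> nat) set" where
  "edge_vecs n \<kappa> = edges n \<rightarrow>\<^sub>E {0..<\<kappa>}"

text \<open>Probability vectors on a finite set of numbers are probability mass functions supported in
  that set; only the \<open>p q l\<close> with labels in \<open>{1..Q}\<close> are meaningful.\<close>

definition sbm_params :: "nat \<Rightarrow> nat \<Rightarrow> nat pmf \<Rightarrow> (nat \<Rightarrow> nat \<Rightarrow> nat pmf) \<Rightarrow> bool" where
  "sbm_params Q \<kappa> \<pi> p \<longleftrightarrow>
     set_pmf \<pi> \<subseteq> {1..Q} \<and>
     (\<forall>q\<in>{1..Q}. \<forall>l\<in>{1..Q}. set_pmf (p q l) \<subseteq> {0..<\<kappa>} \<and> p q l = p l q)"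

text \<open>The law of the edge vector given the states \<open>z\<close>, and its marginal law when the states are
  i.i.d. with law \<open>\<pi>\<close>.\<close>

definition edge_cond_pmf ::
    "nat \<Rightarrow> (nat \<Rightarrow> nat \<Rightarrow> nat pmf) \<Rightarrow> (nat \<Rightarrow> nat) \<Rightarrow> (nat \<times> nat \<Rightarrow> nat) pmf" where
  "edge_cond_pmf n p z = Pi_pmf (edges n) undefined (\<lambda>(i, j). p (z i) (z j))"

definition sbm_pmf ::
    "nat \<Rightarrow> nat pmf \<Rightarrow> (nat \<Rightarrow> nat \<Rightarrow> nat pmf) \<Rightarrow> (nat \<times> nat \<Rightarrow> nat) pmf" where
  "sbm_pmf n \<pi> p = bind_pmf (Pi_pmf {1..n} undefined (\<lambda>_. \<pi>)) (edge_cond_pmf n p)"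

text \<open>Rows are indexed by \<open>states m Q\<close> and columns by \<open>edge_vecs m \<kappa>\<close>, both enumerated in an
  arbitrary order, which does not affect the rank.\<close>

definition cond_mat :: "nat \<Rightarrow> nat \<Rightarrow> nat \<Rightarrow> (nat \<Rightarrow> nat \<Rightarrow> nat pmf) \<Rightarrow> real mat" where
  "cond_mat m Q \<kappa> p = mat (Q ^ m) (\<kappa> ^ (m choose 2))
     (\<lambda>(r, c). pmf (edge_cond_pmf m p (from_nat_into (states m Q) r))
                   (from_nat_into (edge_vecs m \<kappa>) c))"

definition full_row_rank :: "real mat \<Rightarrow> bool" where
  "full_row_rank A \<longleftrightarrow> vec_space.rank (dim_row A) A = dim_row A"

lemma finite_edges [simp]: "finite (edges n)"
  by (rule finite_subset[of _ "{1..n} \<times> {1..n}"]) (auto simp: edges_def)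

lemma pmf_edge_cond_pmf:
  assumes "x \<in> edge_vecs n \<kappa>"
  shows "pmf (edge_cond_pmf n p z) x = (\<Prod>(i, j)\<in>edges n. pmf (p (z i) (z j)) (x (i, j)))"
proof -
  have "x e = undefined" if "e \<notin> edges n" for e
    using assms that by (metis PiE_arb edge_vecs_def)
  then show ?thesis
    by (simp add: edge_cond_pmf_def pmf_Pi' case_prod_unfold)
qed

lemma card_edges: "card (edges n) = n choose 2"
proof (induction n)
  case 0
  have "edges 0 = {}"
    by (auto simp: edges_def)
  then show ?case
    by simp
next
  case (Suc n)
  have "edges (Suc n) = edges n \<union> (\<lambda>i. (i, Suc n)) ` {1..n}"
    by (auto simp: edges_def)
  moreover have "edges n \<inter> (\<lambda>i. (i, Suc n)) ` {1..n} = {}"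
    by (auto simp: edges_def)
  moreover have "card ((\<lambda>i. (i, Suc n)) ` {1..n}) = n"
    by (simp add: card_image inj_on_def)
  ultimately show ?case
    using Suc by (simp add: card_Un_disjoint numeral_2_eq_2)
qed

lemma bij_betw_states:
  "bij_betw (from_nat_into (states m Q)) {..<Q ^ m} (states m Q)"
proof -
  have "finite (states m Q)" "card (states m Q) = Q ^ m"
    by (simp_all add: states_def finite_PiE card_PiE)
  then show ?thesis
    using bij_betw_from_nat_into_finite by metis
qed

lemma bij_betw_edge_vecs:
  "bij_betw (from_nat_into (edge_vecs m \<kappa>)) {..<\<kappa> ^ (m choose 2)} (edge_vecs m \<kappa>)"
proof -
  have "finite (edge_vecs m \<kappa>)" "card (edge_vecs m \<kappa>) = \<kappa> ^ (m choose 2)"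
    by (simp_all add: edge_vecs_def finite_PiE card_PiE card_edges)
  then show ?thesis
    using bij_betw_from_nat_into_finite by metis
qed

end

theory Submission
  imports Defs
begin

text \<open>The proof is a simultaneous diagonalisation. Full row rank of the conditional matrix of the
  clique \<open>K_m\<close> yields, for every \<open>w \<in> states m Q\<close>, a function \<open>f w\<close> of the edges of the clique
  whose conditional expectation given the states \<open>u\<close> is \<open>1\<close> if \<open>u = w\<close> and \<open>0\<close> otherwise
  (\<open>clique_duals\<close>). Arrange \<open>m\<^sup>2\<close> of the nodes in an \<open>m \<times> m\<close> grid. The rows and the columns are
  two partitions of the grid into cliques of size \<open>m\<close>, and no edge occurs twice among all these
  cliques. Multiplying the functions \<open>f\<close> over the rows gives \<open>F z\<close>, over the columns \<open>G w\<close>, for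
  state vectors \<open>z\<close>, \<open>w\<close> of the whole grid; let \<open>h\<close> be a function of one further edge, which joins
  nodes of different rows and different columns.

  The edge variables are independent given the states, so the expectation of \<open>F z * G w * h\<close> is the
  sum over the state vectors \<open>u\<close> of \<open>d u * a u z * b u w * H u\<close>, where \<open>d u\<close> is the probability of
  \<open>u\<close> and \<open>a\<close>, \<open>b\<close>, \<open>H\<close> are the conditional expectations of the three factors
  (\<open>expectation_three_blocks\<close>). For the original parameters \<open>a\<close> and \<open>b\<close> are identity matrices, so
  the expectation is \<open>d z * H z\<close> if \<open>z = w\<close> and \<open>0\<close> otherwise. The other parameters induce the same
  law, so their factors \<open>d'\<close>, \<open>a'\<close>, \<open>b'\<close>, \<open>H'\<close> produce the same numbers. With \<open>h = 1\<close> this shows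
  that the square matrix \<open>b'\<close> is invertible; with general \<open>h\<close> that conjugation by \<open>b'\<close> turns the
  diagonal matrix of \<open>H'\<close> into that of \<open>H\<close>, so that \<open>H' u = H w\<close> wherever the entry \<open>b' u w\<close> does
  not vanish (\<open>joint_diagonalisation_match\<close>).

  The entries of \<open>b'\<close> are products over the columns of the grid, so state vectors of different columns
  can be matched independently. Hence the labels matched in row \<open>r\<close> form a relation \<open>T r\<close>, total and
  onto, such that \<open>T r q l\<close> and \<open>T s q' l'\<close> with \<open>r \<noteq> s\<close> imply \<open>p' q q' = p l l'\<close>. Since no two
  labels have the same connection laws under \<open>p\<close>, three rows are enough to force all the relations
  to be one and the same permutation \<open>\<sigma>\<close> (\<open>label_matching\<close>); this is where \<open>m \<ge> 3\<close> enters. Once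
  \<open>p'\<close> is known to be \<open>p\<close> relabelled by \<open>\<sigma>\<close>, the identity with \<open>h = 1\<close> says that a state vector
  has the same probability under \<open>\<pi>'\<close> as its relabelling has under \<open>\<pi>\<close>, and constant state vectors
  give \<open>\<pi>'\<close>.\<close>

section \<open>Matching the entries of two diagonal matrices\<close>

lemma left_inverse_imp_right_inverse_on:
  fixes A B :: "'a \<Rightarrow> 'a \<Rightarrow> 'f::field"
  assumes "finite U"
    and AB: "\<And>x y. x \<in> U \<Longrightarrow> y \<in> U \<Longrightarrow> (\<Sum>u\<in>U. A x u * B u y) = of_bool (x = y)"
    and "x \<in> U" "y \<in> U"
  shows "(\<Sum>u\<in>U. B x u * A u y) = of_bool (x = y)"
proof -
  define n where "n = card U"
  obtain e where e: "bij_betw e {0..<n} U"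
    using ex_bij_betw_nat_finite[OF \<open>finite U\<close>] unfolding n_def by blast
  have eU: "e i \<in> U" if "i < n" for i
    using e that by (auto dest: bij_betwE)
  have e_inj: "e i = e j \<longleftrightarrow> i = j" if "i < n" "j < n" for i j
    using e that by (auto simp: bij_betw_def inj_on_def)
  define MA where "MA = mat n n (\<lambda>(i, j). A (e i) (e j))"
  define MB where "MB = mat n n (\<lambda>(i, j). B (e i) (e j))"
  have carr: "MA \<in> carrier_mat n n" "MB \<in> carrier_mat n n"
    by (auto simp: MA_def MB_def)
  have reindex: "(\<Sum>k\<in>{0..<n}. g (e k)) = (\<Sum>u\<in>U. g u)" for g :: "'a \<Rightarrow> 'f"
    by (rule sum.reindex_bij_betw[OF e])
  have "MA * MB = 1\<^sub>m n"
  proof (rule eq_matI)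
    fix i j assume "i < dim_row (1\<^sub>m n :: 'f mat)" "j < dim_col (1\<^sub>m n :: 'f mat)"
    then have ij: "i < n" "j < n" by auto
    have "(MA * MB) $$ (i, j) = (\<Sum>k\<in>{0..<n}. A (e i) (e k) * B (e k) (e j))"
      using ij by (simp add: MA_def MB_def scalar_prod_def)
    also have "\<dots> = of_bool (i = j)"
      using reindex[of "\<lambda>u. A (e i) u * B u (e j)"] AB eU e_inj ij by simp
    finally show "(MA * MB) $$ (i, j) = 1\<^sub>m n $$ (i, j)"
      using ij by simp
  qed (auto simp: MA_def MB_def)
  then have BA: "MB * MA = 1\<^sub>m n"
    by (rule mat_mult_left_right_inverse[OF carr])
  obtain i j where ij: "i < n" "j < n" "x = e i" "y = e j"
    using e \<open>x \<in> U\<close> \<open>y \<in> U\<close> by (fastforce simp: bij_betw_def)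
  have "(\<Sum>u\<in>U. B x u * A u y) = (\<Sum>k\<in>{0..<n}. B (e i) (e k) * A (e k) (e j))"
    using reindex[of "\<lambda>u. B x u * A u y"] ij by simp
  also have "\<dots> = (MB * MA) $$ (i, j)"
    using ij by (simp add: MA_def MB_def scalar_prod_def)
  finally show ?thesis
    using BA ij e_inj by simp
qed

text \<open>In matrix notation the hypothesis is \<open>a\<^sup>T D' b = D\<close> with \<open>D\<close> invertible, so \<open>b\<close> has the inverse
  \<open>D\<^bsup>-1\<^esup> a\<^sup>T D'\<close>; an invertible matrix has no zero row and no zero column. If moreover
  \<open>a\<^sup>T D' H' b = D H\<close>, then \<open>b\<^bsup>-1\<^esup> H' b = H\<close>, that is, \<open>H' b = b H\<close>; comparing the entries at
  \<open>(u, w)\<close> gives the last claim.\<close>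

lemma joint_diagonalisation_match:
  fixes a b :: "'a \<Rightarrow> 'a \<Rightarrow> 'f::field"
  assumes "finite U"
    and nz: "\<And>z. z \<in> U \<Longrightarrow> d z \<noteq> 0"
    and one: "\<And>z w. z \<in> U \<Longrightarrow> w \<in> U \<Longrightarrow>
      (\<Sum>u\<in>U. d' u * a u z * b u w) = of_bool (z = w) * d z"
  shows "u \<in> U \<Longrightarrow> \<exists>w\<in>U. b u w \<noteq> 0"
    and "w \<in> U \<Longrightarrow> \<exists>u\<in>U. b u w \<noteq> 0"
    and "\<lbrakk>\<And>z w. z \<in> U \<Longrightarrow> w \<in> U \<Longrightarrow>
      (\<Sum>u\<in>U. d' u * a u z * b u w * h' u) = of_bool (z = w) * d z * h z;
      u \<in> U; w \<in> U; b u w \<noteq> 0\<rbrakk> \<Longrightarrow> h' u = h w"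
proof -
  define A where "A z u = d' u * a u z / d z" for z u
  have left: "(\<Sum>u\<in>U. A z u * b u w) = of_bool (z = w)" if "z \<in> U" "w \<in> U" for z w
  proof -
    have "(\<Sum>u\<in>U. A z u * b u w) = (\<Sum>u\<in>U. d' u * a u z * b u w) / d z"
      by (simp add: A_def sum_divide_distrib)
    then show ?thesis
      using one nz that by simp
  qed
  have right: "(\<Sum>u\<in>U. b x u * A u y) = of_bool (x = y)" if "x \<in> U" "y \<in> U" for x y
    using left_inverse_imp_right_inverse_on[OF \<open>finite U\<close>] left that by blast
  show "\<exists>w\<in>U. b u w \<noteq> 0" if "u \<in> U"
    using right[OF that that] by (auto intro: ccontr)
  show "\<exists>u\<in>U. b u w \<noteq> 0" if "w \<in> U"
    using left[OF that that] by (auto intro: ccontr)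
  assume h: "\<And>z w. z \<in> U \<Longrightarrow> w \<in> U \<Longrightarrow>
      (\<Sum>u\<in>U. d' u * a u z * b u w * h' u) = of_bool (z = w) * d z * h z"
    and uw: "u \<in> U" "w \<in> U" and "b u w \<noteq> 0"
  have conj: "(\<Sum>v\<in>U. A z v * (h' v * b v w)) = of_bool (z = w) * h w" if "z \<in> U" for z
  proof -
    have "(\<Sum>v\<in>U. A z v * (h' v * b v w)) = (\<Sum>v\<in>U. d' v * a v z * b v w * h' v) / d z"
      by (simp add: A_def sum_divide_distrib mult_ac)
    then show ?thesis
      using h nz that uw by auto
  qed
  have "h' u * b u w = (\<Sum>v\<in>U. (\<Sum>z\<in>U. b u z * A z v) * (h' v * b v w))"
    using right uw \<open>finite U\<close> by (simp add: of_bool_def if_distrib[where f = "\<lambda>x. x * c" for c] sum.delta' cong: if_cong)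
  also have "\<dots> = (\<Sum>z\<in>U. b u z * (\<Sum>v\<in>U. A z v * (h' v * b v w)))"
    unfolding sum_distrib_left sum_distrib_right mult.assoc by (rule sum.swap)
  also have "\<dots> = b u w * h w"
    using conj uw \<open>finite U\<close> by (simp add: of_bool_def if_distrib[where f = "\<lambda>x. x * c" for c] if_distrib[where f = "\<lambda>x. c * x" for c] sum.delta' cong: if_cong)
  finally show "h' u = h w"
    using \<open>b u w \<noteq> 0\<close> by simp
qed

section \<open>Dual functions of the clique model\<close>

text \<open>A maximal independent set of columns has as many elements as there are rows, so it is a basis and
  the columns span the whole space.\<close>

lemma full_row_rank_solvable:
  assumes A: "A \<in> carrier_mat nr nc" and "full_row_rank A" and y: "y \<in> carrier_vec nr"
  shows "\<exists>v\<in>carrier_vec nc. A *\<^sub>v v = y"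
proof -
  interpret vec_space "TYPE(real)" nr .
  have rank: "rank A = nr"
    using assms unfolding full_row_rank_def by auto
  obtain S where S: "maximal S (\<lambda>T. T \<subseteq> set (cols A) \<and> lin_indpt T)" "finite S"
    using maximal_exists_superset[of "set (cols A)" "\<lambda>T. T \<subseteq> set (cols A) \<and> lin_indpt T" "{}"]
    by (auto simp: finite_lin_indpt2)
  then have sub: "S \<subseteq> set (cols A)" and li: "lin_indpt S"
    by (auto simp: maximal_def)
  have cols: "set (cols A) \<subseteq> carrier_vec nr"
    using cols_dim A by blast
  have "card S = nr"
    using rank_card_indpt[OF A S(1)] rank by simp
  then have "basis S"
    using li S(2) sub cols dim_is_n by (intro dim_li_is_basis) auto
  then have "y \<in> span S"
    using y by (auto simp: basis_def)
  then have "y \<in> col_space A"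
    using span_is_monotone[OF sub] by (auto simp: col_space_def)
  then show ?thesis
    using col_space_eq[OF A] A by auto
qed

text \<open>The functions \<open>f w\<close> are the columns of a right inverse of the conditional matrix, read off by
  solving one linear system for each unit vector.\<close>

lemma dual_edge_functions:
  assumes "full_row_rank (cond_mat m Q \<kappa> p)"
  obtains f where "\<And>u w. u \<in> states m Q \<Longrightarrow> w \<in> states m Q \<Longrightarrow>
    (\<Sum>x\<in>edge_vecs m \<kappa>. pmf (edge_cond_pmf m p u) x * f w x) = (of_bool (u = w) :: real)"
proof -
  let ?nr = "Q ^ m" and ?nc = "\<kappa> ^ (m choose 2)"
  let ?A = "cond_mat m Q \<kappa> p"
  let ?row = "from_nat_into (states m Q)" and ?col = "from_nat_into (edge_vecs m \<kappa>)"
  have A: "?A \<in> carrier_mat ?nr ?nc"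
    by (simp add: cond_mat_def)
  have "\<exists>g. \<forall>u\<in>states m Q. (\<Sum>x\<in>edge_vecs m \<kappa>. pmf (edge_cond_pmf m p u) x * g x)
      = (of_bool (u = w) :: real)"
    if "w \<in> states m Q" for w
  proof -
    define y where "y = vec ?nr (\<lambda>r. of_bool (?row r = w) :: real)"
    obtain v where v: "v \<in> carrier_vec ?nc" "?A *\<^sub>v v = y"
      using full_row_rank_solvable[OF A assms, of y] by (auto simp: y_def)
    define g where "g x = v $ the_inv_into {..<?nc} ?col x" for x
    have g: "g (?col c) = v $ c" if "c < ?nc" for c
      unfolding g_def using that bij_betw_edge_vecs[of m \<kappa>]
      by (subst the_inv_into_f_f) (auto simp: bij_betw_def)
    have "(\<Sum>x\<in>edge_vecs m \<kappa>. pmf (edge_cond_pmf m p u) x * g x) = of_bool (u = w)"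
      if "u \<in> states m Q" for u
    proof -
      obtain r where r: "r < ?nr" "u = ?row r"
        using bij_betw_states[of m Q] \<open>u \<in> states m Q\<close> by (fastforce simp: bij_betw_def)
      have "(\<Sum>x\<in>edge_vecs m \<kappa>. pmf (edge_cond_pmf m p u) x * g x)
          = (\<Sum>c<?nc. pmf (edge_cond_pmf m p u) (?col c) * g (?col c))"
        by (rule sum.reindex_bij_betw[OF bij_betw_edge_vecs, symmetric])
      also have "\<dots> = (?A *\<^sub>v v) $ r"
        using r v(1) g by (auto simp: cond_mat_def scalar_prod_def lessThan_atLeast0 intro!: sum.cong)
      also have "\<dots> = of_bool (u = w)"
        using v(2) r by (simp add: y_def)
      finally show ?thesis .
    qed
    then show ?thesis by blast
  qed
  then obtain f where "\<forall>w\<in>states m Q. \<forall>u\<in>states m Q.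
      (\<Sum>x\<in>edge_vecs m \<kappa>. pmf (edge_cond_pmf m p u) x * f w x) = (of_bool (u = w) :: real)"
    by metis
  then show ?thesis
    using that by blast
qed

section \<open>From matched labels to a permutation\<close>

text \<open>Suppose that \<open>a\<close> is matched with \<open>b\<close> in \<open>T r\<close> and with \<open>b'\<close> in \<open>T s\<close>, \<open>r \<noteq> s\<close>. For any \<open>d\<close>, the
  third relation matches some \<open>c\<close> with \<open>d\<close>, and then \<open>P b d = P' a c = P b' d\<close>; so \<open>b = b'\<close> because
  \<open>P\<close> separates labels. Thus any two of the relations agree wherever both are defined, and as they
  are total, all three are the graph of the same function, which is onto and hence a permutation.
  With two relations only, the matchings in the first and in the second argument could differ.\<close>

lemma label_matching:
  fixes T :: "nat \<Rightarrow> 'a \<Rightarrow> 'a \<Rightarrow> bool"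
  assumes "finite L"
    and mem: "\<And>r a b. r \<in> {1..3} \<Longrightarrow> T r a b \<Longrightarrow> a \<in> L \<and> b \<in> L"
    and total: "\<And>r a. r \<in> {1..3} \<Longrightarrow> a \<in> L \<Longrightarrow> \<exists>b. T r a b"
    and onto: "\<And>r b. r \<in> {1..3} \<Longrightarrow> b \<in> L \<Longrightarrow> \<exists>a. T r a b"
    and compat: "\<And>r s a b c d. r \<in> {1..3} \<Longrightarrow> s \<in> {1..3} \<Longrightarrow> r \<noteq> s \<Longrightarrow> T r a b \<Longrightarrow> T s c d
      \<Longrightarrow> P' a c = P b d"
    and sep: "\<And>b b'. b \<in> L \<Longrightarrow> b' \<in> L \<Longrightarrow> (\<And>d. d \<in> L \<Longrightarrow> P b d = P b' d) \<Longrightarrow> b = b'"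
  shows "\<exists>\<sigma>. \<sigma> permutes L \<and> (\<forall>a\<in>L. \<forall>c\<in>L. P' a c = P (\<sigma> a) (\<sigma> c))"
proof -
  have cross: "b = b'" if "r \<in> {1..3}" "s \<in> {1..3}" "r \<noteq> s" "T r a b" "T s a b'" for r s a b b'
  proof (rule sep)
    show "b \<in> L" "b' \<in> L"
      using mem that by blast+
    fix d assume "d \<in> L"
    obtain t :: nat where t: "t \<in> {1..3}" "t \<noteq> r" "t \<noteq> s"
    proof -
      have "{1..3} = {1, 2, 3 :: nat}"
        by auto
      then have "\<exists>t\<in>{1..3}. t \<noteq> r \<and> t \<noteq> s"
        by (cases "r = 1 \<or> s = 1"; cases "r = 2 \<or> s = 2") auto
      then show ?thesis
        using that by blast
    qed
    then obtain c where c: "T t c d"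
      using onto \<open>d \<in> L\<close> by blast
    have "P b d = P' a c"
      using compat[of r t a b c d] that t c by simp
    also have "\<dots> = P b' d"
      using compat[of s t a b' c d] that t c by simp
    finally show "P b d = P b' d" .
  qed
  define \<sigma> where "\<sigma> a = (if a \<in> L then SOME b. T 1 a b else a)" for a
  have T1: "T 1 a (\<sigma> a)" if "a \<in> L" for a
    using someI_ex[OF total[of 1 a]] that by (simp add: \<sigma>_def)
  have T2: "T 2 a (\<sigma> a)" if a: "a \<in> L" for a
  proof -
    obtain b where "T 2 a b"
      using total[of 2 a] a by auto
    then show ?thesis
      using cross[of 1 2 a "\<sigma> a" b] T1[OF a] by simp
  qed
  have uniq: "b = \<sigma> a" if "T 1 a b" for a b
    using cross[of 1 2 a b "\<sigma> a"] T2[of a] that mem[of 1 a b] by simp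
  have "\<sigma> ` L = L"
  proof
    show "\<sigma> ` L \<subseteq> L"
      using T1 mem[of 1] by fastforce
    show "L \<subseteq> \<sigma> ` L"
    proof
      fix b assume "b \<in> L"
      then obtain a where "T 1 a b"
        using onto[of 1 b] by auto
      then show "b \<in> \<sigma> ` L"
        using uniq[of a b] mem[of 1 a b] by auto
    qed
  qed
  then have "bij_betw \<sigma> L L"
    using \<open>finite L\<close> by (simp add: bij_betw_def eq_card_imp_inj_on)
  then have "\<sigma> permutes L"
    by (rule bij_imp_permutes) (simp add: \<sigma>_def)
  moreover have "P' a c = P (\<sigma> a) (\<sigma> c)" if "a \<in> L" "c \<in> L" for a c
    using compat[of 1 2 a "\<sigma> a" c "\<sigma> c"] T1 T2 that by simp
  ultimately show ?thesis
    by blast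
qed

section \<open>Independence of disjoint blocks of a product law\<close>

text \<open>All test functions below are real functions of an edge vector that read only some of the edges;
  expectations of products factor as soon as these sets of edges are disjoint.\<close>

definition determined_on :: "'i set \<Rightarrow> (('i \<Rightarrow> 'v) \<Rightarrow> 'b) \<Rightarrow> bool" where
  "determined_on A f \<longleftrightarrow> (\<forall>x y. (\<forall>i\<in>A. x i = y i) \<longrightarrow> f x = f y)"

lemma determined_onD: "determined_on A f \<Longrightarrow> (\<And>i. i \<in> A \<Longrightarrow> x i = y i) \<Longrightarrow> f x = f y"
  unfolding determined_on_def by blast

lemma finite_set_Pi_pmf:
  assumes "finite I" "\<And>i. i \<in> I \<Longrightarrow> finite (set_pmf (P i))"
  shows "finite (set_pmf (Pi_pmf I d P))"
  using assms by (auto simp: set_Pi_pmf)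

lemma expectation_pair_pmf_mult:
  fixes f :: "'a \<Rightarrow> real" and g :: "'b \<Rightarrow> real"
  assumes "finite (set_pmf M)" "finite (set_pmf N)"
  shows "measure_pmf.expectation (pair_pmf M N) (\<lambda>(x, y). f x * g y)
    = measure_pmf.expectation M f * measure_pmf.expectation N g"
proof -
  have "measure_pmf.expectation (pair_pmf M N) (\<lambda>(x, y). f x * g y)
      = (\<Sum>(x, y)\<in>set_pmf M \<times> set_pmf N. (pmf M x * f x) * (pmf N y * g y))"
    using assms
    by (subst integral_measure_pmf[of "set_pmf M \<times> set_pmf N"])
      (auto simp: pmf_pair case_prod_unfold intro!: sum.cong)
  also have "\<dots> = measure_pmf.expectation M f * measure_pmf.expectation N g"
    using assms
    by (simp add: integral_measure_pmf[of "set_pmf M"] integral_measure_pmf[of "set_pmf N"]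
        sum_product sum.cartesian_product)
  finally show ?thesis .
qed

text \<open>Splitting the product law into its coordinates in \<open>A\<close> and its coordinates outside \<open>A\<close> writes the two
  factors as functions of the two components of a pair of independent variables.\<close>

lemma expectation_Pi_pmf_mult:
  fixes f g :: "('i \<Rightarrow> 'v) \<Rightarrow> real"
  assumes "finite I" and fin: "\<And>i. i \<in> I \<Longrightarrow> finite (set_pmf (P i))"
    and AB: "A \<subseteq> I" "B \<subseteq> I" "A \<inter> B = {}" and f: "determined_on A f" and g: "determined_on B g"
  shows "measure_pmf.expectation (Pi_pmf I d P) (\<lambda>x. f x * g x)
    = measure_pmf.expectation (Pi_pmf I d P) f * measure_pmf.expectation (Pi_pmf I d P) g"
proof -
  let ?M = "Pi_pmf A d P" and ?N = "Pi_pmf (I - A) d P"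
  let ?merge = "\<lambda>(x, y) i. if i \<in> A then x i else y i"
  have union: "Pi_pmf I d P = map_pmf ?merge (pair_pmf ?M ?N)"
    using Pi_pmf_union[of A "I - A" d P] \<open>finite I\<close> AB
    by (simp add: finite_subset Un_absorb1)
  have fins: "finite (set_pmf ?M)" "finite (set_pmf ?N)"
    using \<open>finite I\<close> AB fin by (auto intro!: finite_set_Pi_pmf intro: finite_subset)
  have fm: "f (?merge (x, y)) = f x" for x y
    by (rule determined_onD[OF f]) auto
  have gm: "g (?merge (x, y)) = g y" for x y
    using AB by (intro determined_onD[OF g]) auto
  have "measure_pmf.expectation (Pi_pmf I d P) (\<lambda>x. f x * g x)
      = measure_pmf.expectation (pair_pmf ?M ?N) (\<lambda>(x, y). f x * g y)"
    unfolding union by (simp add: case_prod_unfold fm[unfolded split] gm[unfolded split])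
  also have "\<dots> = measure_pmf.expectation ?M f * measure_pmf.expectation ?N g"
    by (rule expectation_pair_pmf_mult[OF fins])
  also have "measure_pmf.expectation ?M f = measure_pmf.expectation (Pi_pmf I d P) f"
    unfolding union by (simp add: case_prod_unfold fm[unfolded split])
  also have "measure_pmf.expectation ?N g = measure_pmf.expectation (Pi_pmf I d P) g"
    unfolding union by (simp add: case_prod_unfold gm[unfolded split])
  finally show ?thesis .
qed

lemma determined_on_prod:
  fixes f :: "'k \<Rightarrow> ('i \<Rightarrow> 'v) \<Rightarrow> real"
  assumes "\<And>k. k \<in> K \<Longrightarrow> determined_on (A k) (f k)"
  shows "determined_on (\<Union>k\<in>K. A k) (\<lambda>x. \<Prod>k\<in>K. f k x)"
  unfolding determined_on_def
proof (intro allI impI prod.cong refl)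
  fix x y :: "'i \<Rightarrow> 'v" and k assume "\<forall>i\<in>\<Union> (A ` K). x i = y i" "k \<in> K"
  then show "f k x = f k y"
    by (intro determined_onD[OF assms]) auto
qed

lemma expectation_Pi_pmf_prod:
  fixes P :: "'i \<Rightarrow> 'v pmf" and f :: "'k \<Rightarrow> ('i \<Rightarrow> 'v) \<Rightarrow> real"
  assumes "finite I" and fin: "\<And>i. i \<in> I \<Longrightarrow> finite (set_pmf (P i))" and "finite K"
    and "\<And>k. k \<in> K \<Longrightarrow> A k \<subseteq> I" and "disjoint_family_on A K"
    and "\<And>k. k \<in> K \<Longrightarrow> determined_on (A k) (f k)"
  shows "measure_pmf.expectation (Pi_pmf I d P) (\<lambda>x. \<Prod>k\<in>K. f k x)
    = (\<Prod>k\<in>K. measure_pmf.expectation (Pi_pmf I d P) (f k))"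
  using \<open>finite K\<close> assms(4-)
proof (induction K rule: finite_induct)
  case empty
  then show ?case by simp
next
  case (insert k K)
  have "measure_pmf.expectation (Pi_pmf I d P) (\<lambda>x. f k x * (\<Prod>k\<in>K. f k x :: real))
    = measure_pmf.expectation (Pi_pmf I d P) (f k) *
      measure_pmf.expectation (Pi_pmf I d P) (\<lambda>x. \<Prod>k\<in>K. f k x)"
  proof (rule expectation_Pi_pmf_mult[OF \<open>finite I\<close> fin])
    show "A k \<subseteq> I" "(\<Union>k\<in>K. A k) \<subseteq> I" "determined_on (A k) (f k)"
      using insert.prems by auto
    show "A k \<inter> (\<Union>k\<in>K. A k) = {}"
      using insert.prems(2) insert.hyps by (auto simp: disjoint_family_on_def)
    show "determined_on (\<Union>k\<in>K. A k) (\<lambda>x. \<Prod>k\<in>K. f k x)"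
      using insert.prems by (intro determined_on_prod) auto
  qed auto
  moreover have "disjoint_family_on A K"
    using insert.prems(2) by (auto simp: disjoint_family_on_def)
  ultimately show ?case
    using insert by simp
qed

text \<open>Reading a subfamily of the coordinates of a product law, renamed by an injection, gives a product
  law again. This is how the law of a clique inside a large graph becomes the law of the \<open>m\<close>-node
  model.\<close>

lemma map_Pi_pmf_reindex:
  assumes "finite A" "inj_on h B" "h ` B \<subseteq> A"
  shows "map_pmf (\<lambda>x b. if b \<in> B then x (h b) else d) (Pi_pmf A d P) = Pi_pmf B d (\<lambda>b. P (h b))"
proof (rule pmf_eqI)
  fix y
  let ?g = "\<lambda>x b. if b \<in> B then x (h b) else d"
  have "finite B"
    using assms by (meson finite_imageD finite_subset)
  show "pmf (map_pmf ?g (Pi_pmf A d P)) y = pmf (Pi_pmf B d (\<lambda>b. P (h b))) y"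
  proof (cases "\<forall>b. b \<notin> B \<longrightarrow> y b = d")
    case True
    \<comment> \<open>The event that the coordinates read through \<open>h\<close> are those of \<open>y\<close>, as a product of events.\<close>
    let ?E = "\<lambda>a. if a \<in> h ` B then {y (the_inv_into B h a)} else UNIV"
    have "?g -` {y} = Pi A ?E"
    proof (intro Set.set_eqI iffI)
      fix x assume "x \<in> ?g -` {y}"
      then have "y = ?g x"
        by auto
      then show "x \<in> Pi A ?E"
        using assms by (auto simp: the_inv_into_f_f)
    next
      fix x assume x: "x \<in> Pi A ?E"
      have "x (h b) = y b" if "b \<in> B" for b
        using x that assms Pi_mem[OF x, of "h b"] by (auto simp: the_inv_into_f_f)
      then show "x \<in> ?g -` {y}"
        using True by (auto simp: fun_eq_iff)
    qed
    then have "pmf (map_pmf ?g (Pi_pmf A d P)) y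
        = (\<Prod>a\<in>A. measure_pmf.prob (P a) (?E a))"
      using measure_Pi_pmf_Pi[of A d P ?E] \<open>finite A\<close> by (simp add: pmf_map)
    also have "\<dots> = (\<Prod>a\<in>h ` B. measure_pmf.prob (P a) (?E a))"
      using assms by (intro prod.mono_neutral_right) auto
    also have "\<dots> = (\<Prod>b\<in>B. pmf (P (h b)) (y b))"
      using assms by (simp add: prod.reindex the_inv_into_f_f measure_pmf_single cong: prod.cong)
    finally show ?thesis
      using True \<open>finite B\<close> by (simp add: pmf_Pi')
  next
    case False
    then have "y \<notin> ?g ` set_pmf (Pi_pmf A d P)"
      by (auto simp: fun_eq_iff)
    then have "pmf (map_pmf ?g (Pi_pmf A d P)) y = 0"
      by (simp add: pmf_eq_0_set_pmf)
    then show ?thesis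
      by (simp only: pmf_Pi[OF \<open>finite B\<close>] False if_False)
  qed
qed

section \<open>Cliques inside a graph\<close>

text \<open>An embedding \<open>\<iota>\<close> of \<open>{1..m}\<close> into the nodes selects a clique; \<open>sub_vec\<close> and \<open>sub_states\<close> read the
  edge vector and the state vector of that clique as data of the \<open>m\<close>-node model. The embeddings are
  increasing, so that they respect the representation of an edge by its increasing pair.\<close>

definition sub_vec :: "nat \<Rightarrow> (nat \<Rightarrow> nat) \<Rightarrow> (nat \<times> nat \<Rightarrow> nat) \<Rightarrow> (nat \<times> nat \<Rightarrow> nat)" where
  "sub_vec m \<iota> x = (\<lambda>e. if e \<in> edges m then x (map_prod \<iota> \<iota> e) else undefined)"

definition sub_states :: "nat \<Rightarrow> (nat \<Rightarrow> nat) \<Rightarrow> (nat \<Rightarrow> nat) \<Rightarrow> (nat \<Rightarrow> nat)" where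
  "sub_states m \<iota> z = restrict (\<lambda>i. z (\<iota> i)) {1..m}"

definition clique_edges :: "nat \<Rightarrow> (nat \<Rightarrow> nat) \<Rightarrow> (nat \<times> nat) set" where
  "clique_edges m \<iota> = map_prod \<iota> \<iota> ` edges m"

lemma finite_states [simp]: "finite (states n Q)"
  by (simp add: states_def finite_PiE)

lemma sub_states_in_states:
  assumes "z \<in> states n Q" "\<iota> ` {1..m} \<subseteq> {1..n}"
  shows "sub_states m \<iota> z \<in> states m Q"
  using assms unfolding states_def sub_states_def by (auto simp: PiE_iff)

lemma edge_cond_pmf_cong:
  assumes "\<And>i j. (i, j) \<in> edges n \<Longrightarrow> p (z i) (z j) = p' (z' i) (z' j)"
  shows "edge_cond_pmf n p z = edge_cond_pmf n p' z'"
  unfolding edge_cond_pmf_def using assms by (intro Pi_pmf_cong) auto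

lemma clique_edges_subset:
  assumes "strict_mono_on {1..m} \<iota>" "\<iota> ` {1..m} \<subseteq> {1..n}"
  shows "clique_edges m \<iota> \<subseteq> edges n"
  unfolding clique_edges_def
proof (rule image_subsetI)
  fix e assume "e \<in> edges m"
  then obtain i j where e: "e = (i, j)" "(i, j) \<in> edges m"
    by (cases e) auto
  then have "i \<in> {1..m}" "j \<in> {1..m}" "i < j"
    by (auto simp: edges_def)
  moreover from this have "\<iota> i < \<iota> j"
    by (intro strict_mono_onD[OF assms(1)])
  ultimately show "map_prod \<iota> \<iota> e \<in> edges n"
    using assms(2) by (auto simp: e edges_def image_subset_iff)
qed

lemma map_edge_cond_pmf_sub_vec:
  assumes mono: "strict_mono_on {1..m} \<iota>" and sub: "\<iota> ` {1..m} \<subseteq> {1..n}"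
  shows "map_pmf (sub_vec m \<iota>) (edge_cond_pmf n p z) = edge_cond_pmf m p (sub_states m \<iota> z)"
proof -
  have inj: "inj_on \<iota> {1..m}"
    using mono by (rule strict_mono_on_imp_inj_on)
  have "inj_on (map_prod \<iota> \<iota>) (edges m)"
    by (rule inj_on_subset[OF map_prod_inj_on[OF inj inj]]) (auto simp: edges_def)
  moreover have "map_prod \<iota> \<iota> ` edges m \<subseteq> edges n"
    using clique_edges_subset[OF mono sub] by (simp add: clique_edges_def)
  ultimately have "map_pmf (sub_vec m \<iota>) (edge_cond_pmf n p z)
      = Pi_pmf (edges m) undefined (\<lambda>e. case map_prod \<iota> \<iota> e of (i, j) \<Rightarrow> p (z i) (z j))"
    unfolding edge_cond_pmf_def sub_vec_def by (subst map_Pi_pmf_reindex) auto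
  also have "\<dots> = edge_cond_pmf m p (sub_states m \<iota> z)"
    unfolding edge_cond_pmf_def by (intro Pi_pmf_cong) (auto simp: edges_def sub_states_def)
  finally show ?thesis .
qed

lemma determined_on_sub_vec: "determined_on (clique_edges m \<iota>) (\<lambda>x. f (sub_vec m \<iota> x))"
proof -
  have "sub_vec m \<iota> x = sub_vec m \<iota> y" if "\<forall>e\<in>clique_edges m \<iota>. x e = y e" for x y
    using that by (auto simp: clique_edges_def sub_vec_def simp del: map_prod_simp)
  then show ?thesis
    unfolding determined_on_def by (metis (no_types))
qed

text \<open>Sharing no edge makes the edge vectors of the cliques independent given the states; covering all
  nodes lets their state vectors together determine the state vector of the \<open>m\<^sup>2\<close> nodes.\<close>

definition clique_partition :: "nat \<Rightarrow> (nat \<Rightarrow> nat \<Rightarrow> nat) \<Rightarrow> bool" where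
  "clique_partition m \<iota> \<longleftrightarrow>
     (\<forall>k\<in>{1..m}. strict_mono_on {1..m} (\<iota> k)) \<and>
     (\<Union>k\<in>{1..m}. \<iota> k ` {1..m}) = {1..m ^ 2} \<and>
     disjoint_family_on (\<lambda>k. clique_edges m (\<iota> k)) {1..m}"

definition partition_edges :: "nat \<Rightarrow> (nat \<Rightarrow> nat \<Rightarrow> nat) \<Rightarrow> (nat \<times> nat) set" where
  "partition_edges m \<iota> = (\<Union>k\<in>{1..m}. clique_edges m (\<iota> k))"

text \<open>\<open>clique_test m \<iota> f z\<close> is designed to detect the state vector \<open>z\<close> of the \<open>m\<^sup>2\<close> nodes: its factor for
  each clique detects the restriction of \<open>z\<close>. Its conditional expectation given the states is
  \<open>test_mean\<close>, which is again a product over the cliques because they share no edge.\<close>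

definition clique_test ::
    "nat \<Rightarrow> (nat \<Rightarrow> nat \<Rightarrow> nat) \<Rightarrow> ((nat \<Rightarrow> nat) \<Rightarrow> (nat \<times> nat \<Rightarrow> nat) \<Rightarrow> real) \<Rightarrow>
     (nat \<Rightarrow> nat) \<Rightarrow> (nat \<times> nat \<Rightarrow> nat) \<Rightarrow> real" where
  "clique_test m \<iota> f z x = (\<Prod>k\<in>{1..m}. f (sub_states m (\<iota> k) z) (sub_vec m (\<iota> k) x))"

definition clique_mean ::
    "nat \<Rightarrow> (nat \<Rightarrow> nat \<Rightarrow> nat pmf) \<Rightarrow> ((nat \<Rightarrow> nat) \<Rightarrow> (nat \<times> nat \<Rightarrow> nat) \<Rightarrow> real) \<Rightarrow>
     (nat \<Rightarrow> nat) \<Rightarrow> (nat \<Rightarrow> nat) \<Rightarrow> real" where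
  "clique_mean m p f u w = measure_pmf.expectation (edge_cond_pmf m p u) (f w)"

definition test_mean ::
    "nat \<Rightarrow> (nat \<Rightarrow> nat \<Rightarrow> nat) \<Rightarrow> (nat \<Rightarrow> nat \<Rightarrow> nat pmf) \<Rightarrow>
     ((nat \<Rightarrow> nat) \<Rightarrow> (nat \<times> nat \<Rightarrow> nat) \<Rightarrow> real) \<Rightarrow> (nat \<Rightarrow> nat) \<Rightarrow> (nat \<Rightarrow> nat) \<Rightarrow> real" where
  "test_mean m \<iota> p f u z =
     (\<Prod>k\<in>{1..m}. clique_mean m p f (sub_states m (\<iota> k) u) (sub_states m (\<iota> k) z))"

lemma clique_partitionD:
  assumes "clique_partition m \<iota>" "k \<in> {1..m}"
  shows "strict_mono_on {1..m} (\<iota> k)" "\<iota> k ` {1..m} \<subseteq> {1..m ^ 2}"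
  using assms unfolding clique_partition_def by blast+

lemma partition_edges_subset:
  assumes "clique_partition m \<iota>" "m ^ 2 \<le> n"
  shows "partition_edges m \<iota> \<subseteq> edges n"
proof -
  have "clique_edges m (\<iota> k) \<subseteq> edges n" if "k \<in> {1..m}" for k
    using clique_partitionD[OF assms(1) that] assms(2) by (intro clique_edges_subset) auto
  then show ?thesis
    unfolding partition_edges_def by blast
qed

lemma determined_on_clique_test: "determined_on (partition_edges m \<iota>) (clique_test m \<iota> f z)"
  unfolding partition_edges_def clique_test_def
  by (intro determined_on_prod determined_on_sub_vec)

lemma finite_edge_law:
  assumes "sbm_params Q \<kappa> \<pi> p" "z \<in> states n Q" "e \<in> edges n"
  shows "finite (set_pmf (case e of (i, j) \<Rightarrow> p (z i) (z j)))"
proof -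
  obtain i j where e: "e = (i, j)" by (cases e)
  then have "z i \<in> {1..Q}" "z j \<in> {1..Q}"
    using assms by (auto simp: states_def edges_def PiE_iff)
  then have "set_pmf (p (z i) (z j)) \<subseteq> {0..<\<kappa>}"
    using assms(1) by (auto simp: sbm_params_def)
  then show ?thesis
    unfolding e split_conv by (rule finite_subset) simp
qed

lemma expectation_clique_test:
  assumes "sbm_params Q \<kappa> \<pi> p" "u \<in> states n Q" "clique_partition m \<iota>" "m ^ 2 \<le> n"
  shows "measure_pmf.expectation (edge_cond_pmf n p u) (clique_test m \<iota> f z) = test_mean m \<iota> p f u z"
proof -
  have sub: "\<iota> k ` {1..m} \<subseteq> {1..n}" if "k \<in> {1..m}" for k
    using clique_partitionD(2)[OF assms(3) that] assms(4) by auto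
  have "measure_pmf.expectation (edge_cond_pmf n p u) (clique_test m \<iota> f z)
     = (\<Prod>k\<in>{1..m}. measure_pmf.expectation (edge_cond_pmf n p u)
          (\<lambda>x. f (sub_states m (\<iota> k) z) (sub_vec m (\<iota> k) x)))"
    unfolding edge_cond_pmf_def clique_test_def
  proof (rule expectation_Pi_pmf_prod[where A = "\<lambda>k. clique_edges m (\<iota> k)"])
    show "disjoint_family_on (\<lambda>k. clique_edges m (\<iota> k)) {1..m}"
      using assms(3) by (simp add: clique_partition_def)
    show "clique_edges m (\<iota> k) \<subseteq> edges n" if "k \<in> {1..m}" for k
      using clique_partitionD(1)[OF assms(3) that] sub[OF that] by (rule clique_edges_subset)
  qed (use finite_edge_law[OF assms(1,2)] determined_on_sub_vec in auto)
  also have "\<dots> = test_mean m \<iota> p f u z"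
    unfolding test_mean_def clique_mean_def
    by (intro prod.cong refl)
      (simp flip: map_edge_cond_pmf_sub_vec[OF clique_partitionD(1)[OF assms(3)] sub])
  finally show ?thesis .
qed

lemma expectation_edge:
  fixes h :: "nat \<Rightarrow> real"
  assumes "(i, j) \<in> edges n"
  shows "measure_pmf.expectation (edge_cond_pmf n p z) (\<lambda>x. h (x (i, j)))
    = measure_pmf.expectation (p (z i) (z j)) h"
proof -
  have "map_pmf (\<lambda>x. x (i, j)) (edge_cond_pmf n p z) = p (z i) (z j)"
    unfolding edge_cond_pmf_def using assms by (simp add: Pi_pmf_component)
  then show ?thesis
    using integral_map_pmf[of "\<lambda>x. x (i, j)" "edge_cond_pmf n p z" h] by simp
qed

section \<open>Moments of the stochastic block model\<close>

text \<open>If the conditional expectation depends only on the states of the first \<open>N\<close> nodes, then the states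
  of the other nodes can be summed out. In this way a model with \<open>n \<ge> m\<^sup>2\<close> nodes is reduced to the
  square matrices indexed by the states of \<open>m\<^sup>2\<close> nodes.\<close>

lemma expectation_sbm_pmf:
  fixes \<phi> :: "(nat \<times> nat \<Rightarrow> nat) \<Rightarrow> real"
  assumes par: "sbm_params Q \<kappa> \<pi> p" and "N \<le> n"
    and \<psi>: "\<And>z. z \<in> states n Q \<Longrightarrow>
      measure_pmf.expectation (edge_cond_pmf n p z) \<phi> = \<psi> (restrict z {1..N})"
  shows "measure_pmf.expectation (sbm_pmf n \<pi> p) \<phi>
    = (\<Sum>u\<in>states N Q. (\<Prod>i\<in>{1..N}. pmf \<pi> (u i)) * \<psi> u)"
proof -
  have supp: "set_pmf (Pi_pmf {1..k} undefined (\<lambda>_. \<pi>)) \<subseteq> states k Q" for k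
    using par by (auto simp: set_Pi_pmf PiE_dflt_def states_def sbm_params_def PiE_iff extensional_def)
  have "measure_pmf.expectation (sbm_pmf n \<pi> p) \<phi>
      = (\<Sum>z\<in>states n Q. pmf (Pi_pmf {1..n} undefined (\<lambda>_. \<pi>)) z *\<^sub>R
          measure_pmf.expectation (edge_cond_pmf n p z) \<phi>)"
    unfolding sbm_pmf_def
  proof (rule pmf_expectation_bind[OF finite_states _ supp])
    show "finite (set_pmf (edge_cond_pmf n p z))" if "z \<in> states n Q" for z
      unfolding edge_cond_pmf_def using finite_edge_law[OF par that]
      by (intro finite_set_Pi_pmf) auto
  qed
  also have "\<dots> = (\<Sum>z\<in>states n Q. pmf (Pi_pmf {1..n} undefined (\<lambda>_. \<pi>)) z *\<^sub>R \<psi> (restrict z {1..N}))"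
    by (intro sum.cong refl) (simp add: \<psi>)
  also have "\<dots> = measure_pmf.expectation (Pi_pmf {1..n} undefined (\<lambda>_. \<pi>)) (\<lambda>z. \<psi> (restrict z {1..N}))"
    using supp by (subst integral_measure_pmf[of "states n Q"]) auto
  also have "\<dots> = measure_pmf.expectation (Pi_pmf {1..N} undefined (\<lambda>_. \<pi>)) \<psi>"
    using Pi_pmf_subset[of "{1..n}" "{1..N}" undefined "\<lambda>_. \<pi>"] \<open>N \<le> n\<close>
    by (simp add: restrict_def)
  also have "\<dots> = (\<Sum>u\<in>states N Q. pmf (Pi_pmf {1..N} undefined (\<lambda>_. \<pi>)) u *\<^sub>R \<psi> u)"
    using supp by (subst integral_measure_pmf[of "states N Q"]) auto
  also have "\<dots> = (\<Sum>u\<in>states N Q. (\<Prod>i\<in>{1..N}. pmf \<pi> (u i)) * \<psi> u)"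
  proof (intro sum.cong refl)
    fix u assume "u \<in> states N Q"
    then have "pmf (Pi_pmf {1..N} undefined (\<lambda>_. \<pi>)) u = (\<Prod>i\<in>{1..N}. pmf \<pi> (u i))"
      by (intro pmf_Pi') (auto simp: states_def PiE_iff extensional_def)
    then show "pmf (Pi_pmf {1..N} undefined (\<lambda>_. \<pi>)) u *\<^sub>R \<psi> u = (\<Prod>i\<in>{1..N}. pmf \<pi> (u i)) * \<psi> u"
      by simp
  qed
  finally show ?thesis .
qed

lemma test_mean_restrict:
  assumes "clique_partition m \<iota>"
  shows "test_mean m \<iota> p f (restrict u {1..m ^ 2}) z = test_mean m \<iota> p f u z"
proof -
  have "sub_states m (\<iota> k) (restrict u {1..m ^ 2}) = sub_states m (\<iota> k) u" if "k \<in> {1..m}" for k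
    using clique_partitionD(2)[OF assms that] by (auto simp: sub_states_def image_subset_iff)
  then show ?thesis
    by (simp add: test_mean_def)
qed

text \<open>The two clique tests and the function of the edge \<open>(i, j)\<close> read disjoint sets of edges, so they are
  independent given the states.\<close>

lemma expectation_three_blocks:
  assumes par: "sbm_params Q \<kappa> \<pi> p" and "m ^ 2 \<le> n"
    and \<rho>: "clique_partition m \<rho>" and \<gamma>: "clique_partition m \<gamma>"
    and disj: "partition_edges m \<rho> \<inter> partition_edges m \<gamma> = {}"
    and e: "(i, j) \<in> edges (m ^ 2)" "(i, j) \<notin> partition_edges m \<rho>" "(i, j) \<notin> partition_edges m \<gamma>"
  shows "measure_pmf.expectation (sbm_pmf n \<pi> p)
      (\<lambda>x. clique_test m \<rho> f z x * clique_test m \<gamma> f w x * h (x (i, j)))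
    = (\<Sum>u\<in>states (m ^ 2) Q. (\<Prod>i\<in>{1..m ^ 2}. pmf \<pi> (u i)) *
        (test_mean m \<rho> p f u z * test_mean m \<gamma> p f u w * measure_pmf.expectation (p (u i) (u j)) h))"
proof -
  let ?F = "clique_test m \<rho> f z" and ?G = "clique_test m \<gamma> f w"
  define \<psi> where "\<psi> u = test_mean m \<rho> p f u z * test_mean m \<gamma> p f u w *
    measure_pmf.expectation (p (u i) (u j)) h" for u
  have sub: "partition_edges m \<rho> \<subseteq> edges n" "partition_edges m \<gamma> \<subseteq> edges n"
    using partition_edges_subset \<rho> \<gamma> \<open>m ^ 2 \<le> n\<close> by blast+
  have en: "(i, j) \<in> edges n"
    using e(1) \<open>m ^ 2 \<le> n\<close> by (auto simp: edges_def)
  have "?F x * ?G x = ?F y * ?G y"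
    if "\<forall>e\<in>partition_edges m \<rho> \<union> partition_edges m \<gamma>. x e = y e" for x y
  proof -
    have "?F x = ?F y" "?G x = ?G y"
      using that by (auto intro!: determined_onD[OF determined_on_clique_test])
    then show ?thesis by simp
  qed
  then have FG: "determined_on (partition_edges m \<rho> \<union> partition_edges m \<gamma>) (\<lambda>x. ?F x * ?G x)"
    unfolding determined_on_def by blast
  have H: "determined_on {(i, j)} (\<lambda>x. h (x (i, j)))"
    by (simp add: determined_on_def)
  have eval: "measure_pmf.expectation (edge_cond_pmf n p u) (\<lambda>x. ?F x * ?G x * h (x (i, j)))
      = \<psi> (restrict u {1..m ^ 2})" if u: "u \<in> states n Q" for u
  proof -
    let ?E = "measure_pmf.expectation (edge_cond_pmf n p u)"
    have prod_rule: "?E (\<lambda>x. a x * b x) = ?E a * ?E b"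
      if "A \<subseteq> edges n" "B \<subseteq> edges n" "A \<inter> B = {}" "determined_on A a" "determined_on B b"
      for A B and a b :: "(nat \<times> nat \<Rightarrow> nat) \<Rightarrow> real"
      unfolding edge_cond_pmf_def
      by (rule expectation_Pi_pmf_mult[OF finite_edges _ that]) (rule finite_edge_law[OF par u])
    have 1: "?E (\<lambda>x. ?F x * ?G x * h (x (i, j))) = ?E (\<lambda>x. ?F x * ?G x) * ?E (\<lambda>x. h (x (i, j)))"
      by (rule prod_rule[OF _ _ _ FG H]) (use sub en e in auto)
    have 2: "?E (\<lambda>x. ?F x * ?G x) = ?E ?F * ?E ?G"
      by (rule prod_rule[OF sub disj determined_on_clique_test determined_on_clique_test])
    have "restrict u {1..m ^ 2} i = u i" "restrict u {1..m ^ 2} j = u j"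
      using e(1) by (simp_all add: edges_def)
    then show ?thesis
      unfolding 1 2 \<psi>_def expectation_clique_test[OF par u \<rho> \<open>m ^ 2 \<le> n\<close>]
        expectation_clique_test[OF par u \<gamma> \<open>m ^ 2 \<le> n\<close>] expectation_edge[OF en]
        test_mean_restrict[OF \<rho>] test_mean_restrict[OF \<gamma>] by (simp only:)
  qed
  show ?thesis
    using expectation_sbm_pmf[OF par \<open>m ^ 2 \<le> n\<close> eval] by (simp only: \<psi>_def)
qed

text \<open>The cliques cover all \<open>m\<^sup>2\<close> nodes, so two state vectors that agree on every clique are equal.\<close>

lemma test_mean_dual:
  assumes \<iota>: "clique_partition m \<iota>"
    and dual: "\<And>u w. u \<in> states m Q \<Longrightarrow> w \<in> states m Q \<Longrightarrow> clique_mean m p f u w = of_bool (u = w)"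
    and u: "u \<in> states (m ^ 2) Q" and z: "z \<in> states (m ^ 2) Q"
  shows "test_mean m \<iota> p f u z = of_bool (u = z)"
proof -
  have cover: "(\<Union>k\<in>{1..m}. \<iota> k ` {1..m}) = {1..m ^ 2}"
    using \<iota> by (simp add: clique_partition_def)
  have "test_mean m \<iota> p f u z
      = (\<Prod>k\<in>{1..m}. of_bool (sub_states m (\<iota> k) u = sub_states m (\<iota> k) z))"
    unfolding test_mean_def
    by (intro prod.cong refl dual sub_states_in_states[OF u] sub_states_in_states[OF z]
        clique_partitionD(2)[OF \<iota>])
  also have "\<dots> = of_bool (\<forall>k\<in>{1..m}. sub_states m (\<iota> k) u = sub_states m (\<iota> k) z)"
    by (cases "\<forall>k\<in>{1..m}. sub_states m (\<iota> k) u = sub_states m (\<iota> k) z") (auto intro: prod_zero)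
  also have "(\<forall>k\<in>{1..m}. sub_states m (\<iota> k) u = sub_states m (\<iota> k) z) \<longleftrightarrow> u = z"
  proof
    assume eq: "\<forall>k\<in>{1..m}. sub_states m (\<iota> k) u = sub_states m (\<iota> k) z"
    show "u = z"
    proof (rule PiE_ext[OF u[unfolded states_def] z[unfolded states_def]])
      fix x assume "x \<in> {1..m ^ 2}"
      then obtain k i where k: "k \<in> {1..m}" "i \<in> {1..m}" "x = \<iota> k i"
        using cover by blast
      then have "sub_states m (\<iota> k) u i = sub_states m (\<iota> k) z i"
        using eq by simp
      then show "u x = z x"
        using k by (simp add: sub_states_def)
    qed
  qed simp
  finally show ?thesis .
qed

section \<open>The rows and the columns of the grid\<close>

text \<open>Row by row numbering of the \<open>m \<times> m\<close> grid, with both coordinates in \<open>{1..m}\<close>. It is increasing in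
  the column for a fixed row and in the row for a fixed column, so rows and columns are increasing
  embeddings of \<open>{1..m}\<close>.\<close>

definition grid_node :: "nat \<Rightarrow> nat \<Rightarrow> nat \<Rightarrow> nat" where
  "grid_node m r c = m * (r - 1) + c"

definition grid_row :: "nat \<Rightarrow> nat \<Rightarrow> nat" where
  "grid_row m x = (x - 1) div m + 1"

definition grid_col :: "nat \<Rightarrow> nat \<Rightarrow> nat" where
  "grid_col m x = (x - 1) mod m + 1"

lemma grid_node_coords:
  assumes "r \<in> {1..m}" "c \<in> {1..m}"
  shows "grid_row m (grid_node m r c) = r" "grid_col m (grid_node m r c) = c"
proof -
  have "grid_node m r c - 1 = m * (r - 1) + (c - 1)" "c - 1 < m"
    using assms by (auto simp: grid_node_def)
  then have "(grid_node m r c - 1) div m = r - 1" "(grid_node m r c - 1) mod m = c - 1"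
    by simp_all
  then show "grid_row m (grid_node m r c) = r" "grid_col m (grid_node m r c) = c"
    using assms by (simp_all add: grid_row_def grid_col_def)
qed

lemma grid_coords_in:
  assumes "x \<in> {1..m ^ 2}"
  shows "grid_row m x \<in> {1..m}" "grid_col m x \<in> {1..m}"
    and "grid_node m (grid_row m x) (grid_col m x) = x"
proof -
  have "m > 0"
    using assms by (cases m) auto
  moreover have "x - 1 < m * m"
    using assms by (auto simp: power2_eq_square)
  ultimately show "grid_row m x \<in> {1..m}" "grid_col m x \<in> {1..m}"
    unfolding grid_row_def grid_col_def
    by (auto simp: Suc_le_eq less_mult_imp_div_less)
  show "grid_node m (grid_row m x) (grid_col m x) = x"
    using assms mult_div_mod_eq[of m "x - 1"] unfolding grid_row_def grid_col_def grid_node_def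
    by auto
qed

lemma grid_node_in:
  assumes "r \<in> {1..m}" "c \<in> {1..m}"
  shows "grid_node m r c \<in> {1..m ^ 2}"
proof -
  have "m * (r - 1) + c \<le> m * (m - 1) + m"
    using assms by (intro add_mono mult_mono) auto
  also have "\<dots> = m ^ 2"
    by (cases m) (auto simp: power2_eq_square)
  finally show ?thesis
    using assms by (auto simp: grid_node_def)
qed

lemma grid_node_less_row:
  assumes "r \<in> {1..m}" "s \<in> {1..m}" "c \<in> {1..m}" "d \<in> {1..m}" "r < s"
  shows "grid_node m r c < grid_node m s d"
proof -
  have "m * (r - 1) + c \<le> m * (r - 1) + m"
    using assms by simp
  also have "\<dots> = m * r"
    using assms by (cases r) auto
  also have "\<dots> \<le> m * (s - 1)"
    using assms by (intro mult_le_mono2) auto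
  finally show ?thesis
    using assms by (simp add: grid_node_def)
qed

lemma row_clique_edge:
  assumes "(a, b) \<in> clique_edges m (grid_node m r)" "r \<in> {1..m}"
  shows "grid_row m a = r \<and> grid_row m b = r \<and> grid_col m a \<noteq> grid_col m b"
  using assms by (auto simp: clique_edges_def edges_def grid_node_coords)

lemma col_clique_edge:
  assumes "(a, b) \<in> clique_edges m (\<lambda>r. grid_node m r c)" "c \<in> {1..m}"
  shows "grid_col m a = c \<and> grid_col m b = c \<and> grid_row m a \<noteq> grid_row m b"
  using assms by (auto simp: clique_edges_def edges_def grid_node_coords)

lemma clique_partition_rows: "clique_partition m (grid_node m)"
  unfolding clique_partition_def
proof (intro conjI ballI)
  show "strict_mono_on {1..m} (grid_node m k)" for k
    by (auto simp: grid_node_def intro!: strict_mono_onI)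
  show "(\<Union>k\<in>{1..m}. grid_node m k ` {1..m}) = {1..m ^ 2}"
  proof (intro equalityI subsetI)
    fix x assume "x \<in> {1..m ^ 2}"
    note grid_coords_in[OF this]
    then show "x \<in> (\<Union>k\<in>{1..m}. grid_node m k ` {1..m})"
      by (metis UN_I imageI)
  qed (use grid_node_in in blast)
  show "disjoint_family_on (\<lambda>k. clique_edges m (grid_node m k)) {1..m}"
    unfolding disjoint_family_on_def by (auto dest!: row_clique_edge)
qed

lemma clique_partition_cols: "clique_partition m (\<lambda>c r. grid_node m r c)"
  unfolding clique_partition_def
proof (intro conjI ballI)
  show "strict_mono_on {1..m} (\<lambda>r. grid_node m r k)" if "k \<in> {1..m}" for k
    using that by (auto intro!: strict_mono_onI grid_node_less_row)
  show "(\<Union>k\<in>{1..m}. (\<lambda>r. grid_node m r k) ` {1..m}) = {1..m ^ 2}"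
  proof (intro equalityI subsetI)
    fix x assume "x \<in> {1..m ^ 2}"
    note grid_coords_in[OF this]
    then show "x \<in> (\<Union>k\<in>{1..m}. (\<lambda>r. grid_node m r k) ` {1..m})"
      by (intro UN_I[of "grid_col m x"] image_eqI[of _ _ "grid_row m x"]) simp_all
  qed (use grid_node_in in blast)
  show "disjoint_family_on (\<lambda>k. clique_edges m (\<lambda>r. grid_node m r k)) {1..m}"
    unfolding disjoint_family_on_def by (auto dest!: col_clique_edge)
qed

lemma rows_cols_edge_disjoint:
  "partition_edges m (grid_node m) \<inter> partition_edges m (\<lambda>c r. grid_node m r c) = {}"
  unfolding partition_edges_def by (auto dest!: row_clique_edge col_clique_edge)

lemma off_grid_edge:
  assumes "r \<in> {1..m}" "s \<in> {1..m}" "c \<in> {1..m}" "d \<in> {1..m}" "r < s" "c \<noteq> d"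
  shows "(grid_node m r c, grid_node m s d) \<in> edges (m ^ 2)"
    "(grid_node m r c, grid_node m s d) \<notin> partition_edges m (grid_node m)"
    "(grid_node m r c, grid_node m s d) \<notin> partition_edges m (\<lambda>c r. grid_node m r c)"
proof -
  show "(grid_node m r c, grid_node m s d) \<in> edges (m ^ 2)"
    using grid_node_less_row[OF assms(1-5)] grid_node_in[of r m c] grid_node_in[of s m d] assms
    by (auto simp: edges_def)
  show "(grid_node m r c, grid_node m s d) \<notin> partition_edges m (grid_node m)"
  proof
    assume "(grid_node m r c, grid_node m s d) \<in> partition_edges m (grid_node m)"
    then obtain k where "k \<in> {1..m}"
      "(grid_node m r c, grid_node m s d) \<in> clique_edges m (grid_node m k)"
      unfolding partition_edges_def by blast
    then show False
      using row_clique_edge[of _ _ m k] grid_node_coords(1)[OF assms(1,3)]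
        grid_node_coords(1)[OF assms(2,4)] \<open>r < s\<close> by fastforce
  qed
  show "(grid_node m r c, grid_node m s d) \<notin> partition_edges m (\<lambda>c r. grid_node m r c)"
  proof
    assume "(grid_node m r c, grid_node m s d) \<in> partition_edges m (\<lambda>c r. grid_node m r c)"
    then obtain k where "k \<in> {1..m}"
      "(grid_node m r c, grid_node m s d) \<in> clique_edges m (\<lambda>r. grid_node m r k)"
      unfolding partition_edges_def by blast
    then show False
      using col_clique_edge[of _ _ m k] grid_node_coords(2)[OF assms(1,3)]
        grid_node_coords(2)[OF assms(2,4)] \<open>c \<noteq> d\<close> by fastforce
  qed
qed

section \<open>Identification of the parameters\<close>

lemma clique_duals:
  assumes par: "sbm_params Q \<kappa> \<pi> p" and "full_row_rank (cond_mat m Q \<kappa> p)"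
  obtains f where "\<And>u w. u \<in> states m Q \<Longrightarrow> w \<in> states m Q \<Longrightarrow>
    clique_mean m p f u w = of_bool (u = w)"
proof -
  obtain f where f: "\<And>u w. u \<in> states m Q \<Longrightarrow> w \<in> states m Q \<Longrightarrow>
      (\<Sum>x\<in>edge_vecs m \<kappa>. pmf (edge_cond_pmf m p u) x * f w x) = (of_bool (u = w) :: real)"
    using dual_edge_functions[OF assms(2)] by blast
  have "clique_mean m p f u w = of_bool (u = w)" if u: "u \<in> states m Q" and w: "w \<in> states m Q" for u w
  proof -
    have "set_pmf (p (u i) (u j)) \<subseteq> {0..<\<kappa>}" if "(i, j) \<in> edges m" for i j
      using par u that by (simp add: sbm_params_def states_def edges_def PiE_iff)
    then have "set_pmf (edge_cond_pmf m p u) \<subseteq> edge_vecs m \<kappa>"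
      unfolding edge_cond_pmf_def edge_vecs_def
      by (fastforce simp: set_Pi_pmf PiE_dflt_def PiE_iff extensional_def)
    moreover have "finite (edge_vecs m \<kappa>)"
      by (simp add: edge_vecs_def finite_PiE)
    ultimately have "clique_mean m p f u w
        = (\<Sum>x\<in>edge_vecs m \<kappa>. pmf (edge_cond_pmf m p u) x * f w x)"
      unfolding clique_mean_def by (subst integral_measure_pmf[of "edge_vecs m \<kappa>"]) auto
    then show ?thesis
      using f[OF u w] by simp
  qed
  then show ?thesis
    using that by blast
qed

text \<open>If \<open>b\<close> and \<open>b'\<close> had the same connection laws, then changing the state of the first node of a clique
  from \<open>b\<close> to \<open>b'\<close> would not change the law of the edges, and no function of the edges could detect
  the change.\<close>

lemma dual_separates_labels:
  assumes dual: "\<And>u w. u \<in> states m Q \<Longrightarrow> w \<in> states m Q \<Longrightarrow> clique_mean m p f u w = of_bool (u = w)"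
    and "m \<ge> 1" and b: "b \<in> {1..Q}" "b' \<in> {1..Q}"
    and eq: "\<And>d. d \<in> {1..Q} \<Longrightarrow> p b d = p b' d"
  shows "b = b'"
proof -
  define z where "z = restrict (\<lambda>_. b) {1..m}"
  define z' where "z' = restrict (\<lambda>i. if i = 1 then b' else b) {1..m}"
  have zs: "z \<in> states m Q" "z' \<in> states m Q"
    using b by (auto simp: z_def z'_def states_def)
  have "edge_cond_pmf m p z = edge_cond_pmf m p z'"
    using b eq by (intro edge_cond_pmf_cong) (auto simp: z_def z'_def edges_def)
  then have "clique_mean m p f z z = clique_mean m p f z' z"
    by (simp add: clique_mean_def)
  then have "z' = z"
    using dual zs by (simp split: if_splits)
  then have "z' 1 = z 1" by simp
  then show ?thesis
    using \<open>m \<ge> 1\<close> by (simp add: z_def z'_def)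
qed

text \<open>This transfers the duality of the tests from \<open>p\<close> to its relabelling \<open>p'\<close>.\<close>

lemma test_mean_relabel:
  assumes \<iota>: "clique_partition m \<iota>" and u: "u \<in> states (m ^ 2) Q"
    and p': "\<And>a c. a \<in> {1..Q} \<Longrightarrow> c \<in> {1..Q} \<Longrightarrow> p' a c = p (\<sigma> a) (\<sigma> c)"
  shows "test_mean m \<iota> p' f u z = test_mean m \<iota> p f (restrict (\<sigma> \<circ> u) {1..m ^ 2}) z"
proof -
  have "edge_cond_pmf m p' (sub_states m (\<iota> k) u)
      = edge_cond_pmf m p (sub_states m (\<iota> k) (restrict (\<sigma> \<circ> u) {1..m ^ 2}))" if k: "k \<in> {1..m}" for k
  proof (rule edge_cond_pmf_cong)
    fix i j assume "(i, j) \<in> edges m"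
    then have ij: "i \<in> {1..m}" "j \<in> {1..m}"
      by (auto simp: edges_def)
    then have \<iota>ij: "\<iota> k i \<in> {1..m ^ 2}" "\<iota> k j \<in> {1..m ^ 2}"
      using clique_partitionD(2)[OF \<iota> k] by blast+
    then have "u (\<iota> k i) \<in> {1..Q}" "u (\<iota> k j) \<in> {1..Q}"
      using u by (auto simp: states_def PiE_iff)
    then show "p' (sub_states m (\<iota> k) u i) (sub_states m (\<iota> k) u j)
      = p (sub_states m (\<iota> k) (restrict (\<sigma> \<circ> u) {1..m ^ 2}) i)
          (sub_states m (\<iota> k) (restrict (\<sigma> \<circ> u) {1..m ^ 2}) j)"
      using ij \<iota>ij p' by (simp add: sub_states_def)
  qed
  then show ?thesis
    unfolding test_mean_def clique_mean_def by (intro prod.cong) simp_all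
qed

text \<open>The state vector of the grid with \<open>v\<close> in the second column and \<open>u\<close> in all the others. Taking \<open>v = u\<close>
  gives a vector with equal columns.\<close>

definition glue_columns :: "nat \<Rightarrow> (nat \<Rightarrow> nat) \<Rightarrow> (nat \<Rightarrow> nat) \<Rightarrow> (nat \<Rightarrow> nat)" where
  "glue_columns m u v =
     restrict (\<lambda>x. if grid_col m x = 2 then v (grid_row m x) else u (grid_row m x)) {1..m ^ 2}"

lemma glue_columns_in_states:
  assumes "u \<in> states m Q" "v \<in> states m Q"
  shows "glue_columns m u v \<in> states (m ^ 2) Q"
proof -
  have "u (grid_row m x) \<in> {1..Q}" "v (grid_row m x) \<in> {1..Q}" if "x \<in> {1..m ^ 2}" for x
    using assms grid_coords_in(1)[OF that] unfolding states_def by (blast dest: PiE_mem)+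
  then show ?thesis
    unfolding glue_columns_def states_def by auto
qed

lemma sub_states_glue_columns:
  assumes "u \<in> states m Q" "v \<in> states m Q" "c \<in> {1..m}"
  shows "sub_states m (\<lambda>r. grid_node m r c) (glue_columns m u v) = (if c = 2 then v else u)"
proof
  fix r
  show "sub_states m (\<lambda>r. grid_node m r c) (glue_columns m u v) r = (if c = 2 then v else u) r"
  proof (cases "r \<in> {1..m}")
    case True
    then show ?thesis
      using grid_node_coords[OF True assms(3)] grid_node_in[OF True assms(3)]
      by (auto simp: sub_states_def glue_columns_def)
  next
    case False
    then have "u r = undefined" "v r = undefined"
      using assms(1,2) by (auto simp: states_def PiE_iff extensional_def)
    then show ?thesis
      using False by (auto simp: sub_states_def)
  qed
qed

lemma pmf_eqI_expectation:
  fixes M N :: "'a pmf"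
  assumes "\<And>h :: 'a \<Rightarrow> real. measure_pmf.expectation M h = measure_pmf.expectation N h"
  shows "M = N"
proof (rule pmf_eqI)
  fix x
  show "pmf M x = pmf N x"
    using assms[of "indicator {x}"] by (simp add: measure_pmf_single)
qed

theorem theorem2:
  fixes m Q \<kappa> n :: nat
    and \<pi> \<pi>' :: "nat pmf"
    and p p' :: "nat \<Rightarrow> nat \<Rightarrow> nat pmf"
  assumes "m \<ge> 3" and "Q \<ge> 1" and "\<kappa> \<ge> 2" and "n \<ge> m ^ 2"
    and "sbm_params Q \<kappa> \<pi> p"
    and "full_row_rank (cond_mat m Q \<kappa> p)"
    and "\<And>q. q \<in> {1..Q} \<Longrightarrow> pmf \<pi> q > 0"
    and "sbm_params Q \<kappa> \<pi>' p'"
    and "sbm_pmf n \<pi>' p' = sbm_pmf n \<pi> p"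
  shows "\<exists>\<sigma>. \<sigma> permutes {1..Q} \<and>
           (\<forall>q\<in>{1..Q}. pmf \<pi>' q = pmf \<pi> (\<sigma> q)) \<and>
           (\<forall>q\<in>{1..Q}. \<forall>l\<in>{1..Q}. p' q l = p (\<sigma> q) (\<sigma> l))"
proof -
  note par = assms(5) and par' = assms(8)
  obtain f where dual: "\<And>u w. u \<in> states m Q \<Longrightarrow> w \<in> states m Q \<Longrightarrow>
      clique_mean m p f u w = of_bool (u = w)"
    using clique_duals[OF par assms(6)] by blast
  let ?N = "m ^ 2" and ?rows = "grid_node m" and ?cols = "\<lambda>c r. grid_node m r c"
  let ?U = "states ?N Q"
  define d where "d z = (\<Prod>i\<in>{1..?N}. pmf \<pi> (z i))" for z
  define d' where "d' u = (\<Prod>i\<in>{1..?N}. pmf \<pi>' (u i))" for u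
  define a where "a u z = test_mean m ?rows p' f u z" for u z
  define b where "b u w = test_mean m ?cols p' f u w" for u w
  have d_nz: "d z \<noteq> 0" if "z \<in> ?U" for z
  proof -
    have "pmf \<pi> (z i) \<noteq> 0" if "i \<in> {1..?N}" for i
      using assms(7)[of "z i"] that \<open>z \<in> ?U\<close> by (auto simp: states_def PiE_iff)
    then show ?thesis
      by (simp add: d_def)
  qed
  \<comment> \<open>The columns 1 and 2 merely fix an edge off the rows and the columns for each pair of rows.\<close>
  have moment: "(\<Sum>u\<in>?U. d' u * a u z * b u w * measure_pmf.expectation (p' (u i) (u j)) h)
      = of_bool (z = w) * d z * measure_pmf.expectation (p (z i) (z j)) h"
    if rs: "r \<in> {1..m}" "s \<in> {1..m}" "r < s" and ij: "i = grid_node m r 1" "j = grid_node m s 2"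
      and zw: "z \<in> ?U" "w \<in> ?U"
    for r s i j z w and h :: "nat \<Rightarrow> real"
  proof -
    have "1 \<in> {1..m}" "2 \<in> {1..m}" "(1::nat) \<noteq> 2"
      using \<open>m \<ge> 3\<close> by auto
    note off = off_grid_edge[OF rs(1,2) this(1,2) rs(3) this(3), folded ij]
    note blocks = expectation_three_blocks[OF _ \<open>n \<ge> m ^ 2\<close> clique_partition_rows
        clique_partition_cols rows_cols_edge_disjoint off, of Q \<kappa>]
    have "(\<Sum>u\<in>?U. d' u * (a u z * b u w * measure_pmf.expectation (p' (u i) (u j)) h))
        = (\<Sum>u\<in>?U. d u * (test_mean m ?rows p f u z * test_mean m ?cols p f u w *
            measure_pmf.expectation (p (u i) (u j)) h))"
      unfolding d_def d'_def a_def b_def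
      using blocks[OF par, of f z w h] blocks[OF par', of f z w h] assms(9) by simp
    also have "\<dots> = (\<Sum>u\<in>?U. if u = z
        then of_bool (z = w) * d z * measure_pmf.expectation (p (z i) (z j)) h else 0)"
    proof (rule sum.cong[OF refl])
      fix u assume u: "u \<in> ?U"
      show "d u * (test_mean m ?rows p f u z * test_mean m ?cols p f u w *
            measure_pmf.expectation (p (u i) (u j)) h)
        = (if u = z then of_bool (z = w) * d z * measure_pmf.expectation (p (z i) (z j)) h else 0)"
        by (simp add: test_mean_dual[OF clique_partition_rows dual u zw(1)]
            test_mean_dual[OF clique_partition_cols dual u zw(2)])
    qed
    also have "\<dots> = of_bool (z = w) * d z * measure_pmf.expectation (p (z i) (z j)) h"
      using zw by (simp add: sum.delta)
    finally show ?thesis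
      by (simp only: mult.assoc)
  qed
  have one: "(\<Sum>u\<in>?U. d' u * a u z * b u w) = of_bool (z = w) * d z"
    if "z \<in> ?U" "w \<in> ?U" for z w
    using moment[of 1 2 "grid_node m 1 1" "grid_node m 2 2" z w "\<lambda>_. 1"] that \<open>m \<ge> 3\<close> by simp
  have b_row: "\<exists>w\<in>?U. b u w \<noteq> 0" if "u \<in> ?U" for u
    by (rule joint_diagonalisation_match(1)[where U = ?U and d = d and d' = d' and a = a and b = b, OF finite_states])
      (simp_all add: d_nz one that)
  have b_col: "\<exists>u\<in>?U. b u w \<noteq> 0" if "w \<in> ?U" for w
    by (rule joint_diagonalisation_match(2)[where U = ?U and d = d and d' = d' and a = a and b = b, OF finite_states])
      (simp_all add: d_nz one that)
  have b_law: "p' (u i) (u j) = p (w i) (w j)"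
    if rs: "r \<in> {1..m}" "s \<in> {1..m}" "r < s" and ij: "i = grid_node m r 1" "j = grid_node m s 2"
      and uw: "u \<in> ?U" "w \<in> ?U" "b u w \<noteq> 0"
    for r s i j u w
  proof (rule pmf_eqI_expectation)
    fix h :: "nat \<Rightarrow> real"
    show "measure_pmf.expectation (p' (u i) (u j)) h = measure_pmf.expectation (p (w i) (w j)) h"
      by (rule joint_diagonalisation_match(3)[where U = ?U and d = d and d' = d' and a = a and b = b
            and h' = "\<lambda>u. measure_pmf.expectation (p' (u i) (u j)) h"
            and h = "\<lambda>z. measure_pmf.expectation (p (z i) (z j)) h"])
        (simp_all only: finite_states d_nz one moment[OF rs ij] uw not_False_eq_True)
  qed
  \<comment> \<open>Pairs of state vectors of a single column that the matrix \<open>b\<close> matches.\<close>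
  define S where "S u w \<longleftrightarrow> u \<in> states m Q \<and> w \<in> states m Q \<and> clique_mean m p' f u w \<noteq> 0" for u w
  have b_nz: "b u w \<noteq> 0 \<longleftrightarrow> (\<forall>c\<in>{1..m}. S (sub_states m (?cols c) u) (sub_states m (?cols c) w))"
    if "u \<in> ?U" "w \<in> ?U" for u w
    using sub_states_in_states[OF that(1) clique_partitionD(2)[OF clique_partition_cols]]
      sub_states_in_states[OF that(2) clique_partitionD(2)[OF clique_partition_cols]]
    by (simp add: b_def test_mean_def S_def)
  have one_in: "1 \<in> {1..m}"
    using \<open>m \<ge> 3\<close> by simp
  have S_total: "\<exists>w. S u w" if u: "u \<in> states m Q" for u
  proof -
    obtain w where "w \<in> ?U" "b (glue_columns m u u) w \<noteq> 0"
      using b_row[OF glue_columns_in_states[OF u u]] by blast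
    then have "S (sub_states m (?cols 1) (glue_columns m u u)) (sub_states m (?cols 1) w)"
      using b_nz[OF glue_columns_in_states[OF u u]] one_in by blast
    then show ?thesis
      using sub_states_glue_columns[OF u u one_in] by auto
  qed
  have S_onto: "\<exists>u. S u w" if w: "w \<in> states m Q" for w
  proof -
    obtain u where "u \<in> ?U" "b u (glue_columns m w w) \<noteq> 0"
      using b_col[OF glue_columns_in_states[OF w w]] by blast
    then have "S (sub_states m (?cols 1) u) (sub_states m (?cols 1) (glue_columns m w w))"
      using b_nz[OF _ glue_columns_in_states[OF w w]] one_in by blast
    then show ?thesis
      using sub_states_glue_columns[OF w w one_in] by auto
  qed
  have S_compat: "p' (u r) (v s) = p (w r) (x s)"
    if S: "S u w" "S v x" and rs: "r \<in> {1..m}" "s \<in> {1..m}" "r < s" for u v w x r s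
  proof -
    have st: "u \<in> states m Q" "v \<in> states m Q" "w \<in> states m Q" "x \<in> states m Q"
      using S by (auto simp: S_def)
    let ?u = "glue_columns m u v" and ?w = "glue_columns m w x"
    note U = glue_columns_in_states[OF st(1,2)] glue_columns_in_states[OF st(3,4)]
    have nz: "b ?u ?w \<noteq> 0"
      unfolding b_nz[OF U] using sub_states_glue_columns[OF st(1,2)]
        sub_states_glue_columns[OF st(3,4)] S by simp
    \<comment> \<open>The edge from row \<open>r\<close> of a column matched by \<open>S u w\<close> to row \<open>s\<close> of one matched by \<open>S v x\<close>.\<close>
    define i j where "i = grid_node m r 1" and "j = grid_node m s 2"
    have "p' (?u i) (?u j) = p (?w i) (?w j)"
      by (rule b_law[OF rs i_def j_def U nz])
    moreover have "?u i = u r" "?u j = v s" "?w i = w r" "?w j = x s"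
      using rs \<open>m \<ge> 3\<close> grid_node_in[of r m 1] grid_node_in[of s m 2]
        grid_node_coords[of r m 1] grid_node_coords[of s m 2]
      by (auto simp: glue_columns_def i_def j_def)
    ultimately show ?thesis by simp
  qed
  define T where "T r q l \<longleftrightarrow> (\<exists>u w. S u w \<and> u r = q \<and> w r = l)" for r q l
  have const: "restrict (\<lambda>_. q) {1..m} \<in> states m Q" if "q \<in> {1..Q}" for q
    using that by (auto simp: states_def)
  have "\<exists>\<sigma>. \<sigma> permutes {1..Q} \<and> (\<forall>q\<in>{1..Q}. \<forall>l\<in>{1..Q}. p' q l = p (\<sigma> q) (\<sigma> l))"
  proof (rule label_matching[where T = T])
    show "finite {1..Q}" by simp
    show mem: "q \<in> {1..Q} \<and> l \<in> {1..Q}" if "r \<in> {1..3}" "T r q l" for r q l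
    proof -
      have "r \<in> {1..m}"
        using that(1) \<open>m \<ge> 3\<close> by auto
      then show ?thesis
        using that(2) unfolding T_def S_def states_def by (auto dest: PiE_mem)
    qed
    show "\<exists>l. T r q l" if r: "r \<in> {1..3}" and q: "q \<in> {1..Q}" for r q
    proof -
      obtain w where "S (restrict (\<lambda>_. q) {1..m}) w"
        using S_total const q by blast
      moreover have "restrict (\<lambda>_. q) {1..m} r = q"
        using r \<open>m \<ge> 3\<close> by auto
      ultimately show ?thesis
        unfolding T_def by blast
    qed
    show "\<exists>q. T r q l" if r: "r \<in> {1..3}" and l: "l \<in> {1..Q}" for r l
    proof -
      obtain u where "S u (restrict (\<lambda>_. l) {1..m})"
        using S_onto const l by blast
      moreover have "restrict (\<lambda>_. l) {1..m} r = l"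
        using r \<open>m \<ge> 3\<close> by auto
      ultimately show ?thesis
        unfolding T_def by blast
    qed
    show "p' q q' = p l l'"
      if rs: "r \<in> {1..3}" "s \<in> {1..3}" "r \<noteq> s" and T: "T r q l" "T s q' l'" for r s q l q' l'
    proof -
      have rs_m: "r \<in> {1..m}" "s \<in> {1..m}"
        using rs \<open>m \<ge> 3\<close> by auto
      obtain u w v x where S: "S u w" "S v x" and eq: "u r = q" "w r = l" "v s = q'" "x s = l'"
        using T unfolding T_def by blast
      show ?thesis
      proof (cases "r < s")
        case True
        then show ?thesis
          using S_compat[OF S rs_m] eq by simp
      next
        case False
        \<comment> \<open>Edges are stored with the smaller node first, so this order of rows needs the symmetry of the laws.\<close>
        then have "p' q' q = p l' l"
          using S_compat[OF S(2,1) rs_m(2,1)] eq rs(3) by simp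
        moreover have "p' q' q = p' q q'" "p l' l = p l l'"
          using par par' mem[OF rs(1) T(1)] mem[OF rs(2) T(2)] by (auto simp: sbm_params_def)
        ultimately show ?thesis by simp
      qed
    qed
    show "l = l'" if "l \<in> {1..Q}" "l' \<in> {1..Q}" "\<And>q. q \<in> {1..Q} \<Longrightarrow> p l q = p l' q" for l l'
      using dual_separates_labels[where f = f, OF dual _ that] \<open>m \<ge> 3\<close> by simp
  qed
  then obtain \<sigma> where \<sigma>: "\<sigma> permutes {1..Q}"
    and p'_eq: "\<And>q l. q \<in> {1..Q} \<Longrightarrow> l \<in> {1..Q} \<Longrightarrow> p' q l = p (\<sigma> q) (\<sigma> l)"
    by blast
  have "pmf \<pi>' q = pmf \<pi> (\<sigma> q)" if q: "q \<in> {1..Q}" for q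
  proof -
    let ?relabel = "\<lambda>u. restrict (\<sigma> \<circ> u) {1..?N}"
    define u where "u = restrict (\<lambda>_. q) {1..?N}"
    have u: "u \<in> ?U"
      using q by (auto simp: u_def states_def)
    have relabel_in: "?relabel v \<in> ?U" if "v \<in> ?U" for v
      using that permutes_in_image[OF \<sigma>] unfolding states_def by (auto simp: PiE_iff)
    have relabel_inj: "?relabel v = ?relabel u \<longleftrightarrow> v = u" if v: "v \<in> ?U" for v
    proof
      assume eq: "?relabel v = ?relabel u"
      show "v = u"
      proof (rule PiE_ext[OF v[unfolded states_def] u[unfolded states_def]])
        fix x assume "x \<in> {1..?N}"
        then have "\<sigma> (v x) = \<sigma> (u x)"
          using fun_cong[OF eq, of x] by simp
        then show "v x = u x"
          using permutes_inj[OF \<sigma>] by (simp add: inj_eq)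
      qed
    qed simp
    have ab: "a v (?relabel u) = of_bool (v = u)" "b v (?relabel u) = of_bool (v = u)"
      if v: "v \<in> ?U" for v
      unfolding a_def b_def
      by (simp_all only: test_mean_relabel[where p = p and p' = p' and \<sigma> = \<sigma>, OF clique_partition_rows v p'_eq]
          test_mean_relabel[where p = p and p' = p' and \<sigma> = \<sigma>, OF clique_partition_cols v p'_eq]
          test_mean_dual[OF clique_partition_rows dual relabel_in[OF v] relabel_in[OF u]]
          test_mean_dual[OF clique_partition_cols dual relabel_in[OF v] relabel_in[OF u]]
          relabel_inj[OF v])
    \<comment> \<open>Of the moment identity for \<open>z = w = ?relabel u\<close> only the term \<open>v = u\<close> remains.\<close>
    have "d (?relabel u) = (\<Sum>v\<in>?U. d' v * a v (?relabel u) * b v (?relabel u))"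
      using one[OF relabel_in[OF u] relabel_in[OF u]] by simp
    also have "\<dots> = (\<Sum>v\<in>?U. if v = u then d' u else 0)"
    proof (rule sum.cong[OF refl])
      fix v assume "v \<in> ?U"
      then show "d' v * a v (?relabel u) * b v (?relabel u) = (if v = u then d' u else 0)"
        by (simp add: ab del: One_nat_def)
    qed
    also have "\<dots> = d' u"
      using u by (simp add: sum.delta)
    finally have "pmf \<pi>' q ^ ?N = pmf \<pi> (\<sigma> q) ^ ?N"
      by (simp add: d_def d'_def u_def)
    then show ?thesis
      by (rule power_eq_imp_eq_base) (use \<open>m \<ge> 3\<close> in auto)
  qed
  then show ?thesis
    using \<sigma> p'_eq by blast
qed

end
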